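(* Let $X,Y$ be Banach spaces, $T:X\to Y$ a bounded linear operator and $1\le p<2$. If $T$ is of weak Haar type $p$, then $T$ is of Haar type $r$ for every $r$ with $1\le r<p$.
   Context: Dyadic intervals: $\Delta_k^{(j)}:=[\frac{j-1}{2^k},\frac{j}{2^k})$. Haar functions: for $k\ge1$, integer $j$, $\chi_k^{(j)}(t)=+2^{(k-1)/2}$ on $\Delta_k^{(2j-1)}$, $-2^{(k-1)/2}$ on $\Delta_k^{(2j)}$, $0$ otherwise, $t\in[0,1)$. $\mathbb D_1^n:=\{(k,j):k=1,\dots,n;\ j=1,\dots,2^{k-1}\}$. $\|f|L_q\|$ is the Bochner $L_q([0,1))$-norm of a vector-valued function. $\tau(T|\mathcal H(\mathbb D_1^n))$ is the least $c\ge0$ with $\|\sum_{(k,j)\in\mathbb D_1^n}Tx_k^{(j)}\chi_k^{(j)}|L_2\|\le c(\sum_{(k,j)\in\mathbb D_1^n}\|x_k^{(j)}\|^2)^{1/2}$ for all $x_k^{(j)}\in X$. For $1\le q\le2$, $\tau_q(T|\mathcal H(\mathbb D_1^n))$ is the least $c\ge0$ with $\|\sum_{(k,j)\in\mathbb D_1^n}Tx_k^{(j)}\chi_k^{(j)}|L_q\|\le c(\sum_{k=1}^n\|\sum_{j=1}^{2^{k-1}}x_k^{(j)}\chi_k^{(j)}|L_q\|^q)^{1/q}$ for all $x_k^{(j)}\in X$. $T$ is of Haar type $q$ ($1\le q\le 2$) if $\sup_n\tau_q(T|\mathcal H(\mathbb D_1^n))<\infty$. For $1\le p<2$, $T$ is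 of weak Haar type $p$ if there is $c\ge0$ with $\tau(T|\mathcal H(\mathbb D_1^n))\le c\,n^{1/p-1/2}$ for all $n\in\mathbb N$. *)

theory Defs
  imports "HOL-Analysis.Analysis"
begin

definition dyadic :: "nat \<Rightarrow> int \<Rightarrow> real set" where
  "dyadic k j = {(real_of_int j - 1) / 2 ^ k ..< real_of_int j / 2 ^ k}"

definition haar :: "nat \<Rightarrow> int \<Rightarrow> real \<Rightarrow> real" where
  "haar k j t =
     (if t \<in> {0..<1} \<and> t \<in> dyadic k (2 * j - 1) then 2 powr ((real k - 1) / 2)
      else if t \<in> {0..<1} \<and> t \<in> dyadic k (2 * j) then - (2 powr ((real k - 1) / 2))
      else 0)"

definition DD :: "nat \<Rightarrow> (nat \<times> int) set" where
  "DD n = {(k, j). k \<in> {1..n} \<and> j \<in> {1..(2::int) ^ (k - 1)}}"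

definition Lq_norm :: "real \<Rightarrow> (real \<Rightarrow> 'a::real_normed_vector) \<Rightarrow> real" where
  "Lq_norm q f = (LINT t:{0..<1}|lborel. norm (f t) powr q) powr (1 / q)"

definition haar_tau :: "nat \<Rightarrow> ('a::real_normed_vector \<Rightarrow> 'b::real_normed_vector) \<Rightarrow> real" where
  "haar_tau n T = Inf {c. 0 \<le> c \<and>
     (\<forall>x :: nat \<Rightarrow> int \<Rightarrow> 'a.
        Lq_norm 2 (\<lambda>t. \<Sum>(k, j)\<in>DD n. haar k j t *\<^sub>R T (x k j))
          \<le> c * sqrt (\<Sum>(k, j)\<in>DD n. (norm (x k j))\<^sup>2))}"

definition haar_tau_q :: "real \<Rightarrow> nat \<Rightarrow> ('a::real_normed_vector \<Rightarrow> 'b::real_normed_vector) \<Rightarrow> real" where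
  "haar_tau_q q n T = Inf {c. 0 \<le> c \<and>
     (\<forall>x :: nat \<Rightarrow> int \<Rightarrow> 'a.
        Lq_norm q (\<lambda>t. \<Sum>(k, j)\<in>DD n. haar k j t *\<^sub>R T (x k j))
          \<le> c * (\<Sum>k = 1..n. (Lq_norm q (\<lambda>t. \<Sum>j = 1..(2::int) ^ (k - 1). haar k j t *\<^sub>R x k j)) powr q) powr (1 / q))}"

definition haar_type :: "real \<Rightarrow> ('a::real_normed_vector \<Rightarrow> 'b::real_normed_vector) \<Rightarrow> bool" where
  "haar_type q T \<longleftrightarrow> bdd_above (range (\<lambda>n. haar_tau_q q n T))"

definition weak_haar_type :: "real \<Rightarrow> ('a::real_normed_vector \<Rightarrow> 'b::real_normed_vector) \<Rightarrow> bool" where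
  "weak_haar_type p T \<longleftrightarrow> (\<exists>c\<ge>0. \<forall>n\<ge>1. haar_tau n T \<le> c * real n powr (1 / p - 1 / 2))"

end

theory Submission
  imports Defs
begin

text \<open>
Haar polynomials are dyadic martingales whose differences have predictable norm, so they are
encoded as finite binary trees of increments. Three steps lead from the weak type to the type.

First, the weak type inequality for \<open>n\<close> levels holds, with the same constant, for every tree with at
most \<open>n\<close> nonzero increments along each path: at a zero increment one keeps the better of the two
subtrees.

Secondly, choose \<open>r < s < p\<close>, let \<open>A\<close> be the sum of the \<open>s\<close>-th powers of the norms of the increments
along a path, and stop just before \<open>A\<close> exceeds \<open>l\<^sup>s\<close>. There are at most \<open>(l / 2\<^sup>i)\<^sup>s\<close> remaining
increments of norm between \<open>2\<^sup>i\<close> and \<open>2 * 2\<^sup>i\<close>, so the first step bounds their contribution, and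
since \<open>s < p\<close> these bounds sum geometrically over \<open>i\<close>. With \<open>S\<close> the image of the full sum this gives
\<open>E (min \<bar>S\<bar> l)\<^sup>2 \<le> C l\<^bsup>2-s\<^esup> E (min A l\<^sup>s)\<close>.

Finally, multiplying by \<open>l\<^bsup>r-2\<^esup>\<close> and summing over \<open>l = 2\<^sup>m\<close> yields \<open>E \<bar>S\<bar>\<^sup>r \<le> C E A\<^bsup>r/s\<^esup>\<close>, where
\<open>A\<^bsup>r/s\<^esup>\<close> is at most the sum of the \<open>r\<close>-th powers because \<open>r < s\<close>.
\<close>

section \<open>Binary trees of increments\<close>

text \<open>A Haar function takes opposite values on the two halves of its support, so a node stores
  only the increment on the left half; the right branch carries its negative.\<close>

datatype 'a mtree = Leaf | Node 'a "'a mtree" "'a mtree"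

fun paths :: "'a::uminus mtree \<Rightarrow> 'a list set" where
  "paths Leaf = {[]}"
| "paths (Node x l r) = (#) x ` paths l \<union> (#) (- x) ` paths r"

text \<open>The mean over independent fair signs. It is defined by recursion because the set
  \<open>paths\<close> forgets multiplicities: below a zero increment the two branches may contain
  the same path.\<close>

fun expect :: "('a::uminus list \<Rightarrow> real) \<Rightarrow> 'a mtree \<Rightarrow> real" where
  "expect F Leaf = F []"
| "expect F (Node x l r) = (expect (\<lambda>p. F (x # p)) l + expect (\<lambda>p. F (- x # p)) r) / 2"

fun complete_tree :: "nat \<Rightarrow> 'a mtree \<Rightarrow> bool" where
  "complete_tree n Leaf \<longleftrightarrow> n = 0"
| "complete_tree n (Node x l r) \<longleftrightarrow> (\<exists>m. n = Suc m \<and> complete_tree m l \<and> complete_tree m r)"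

fun nonzeros :: "'a::zero mtree \<Rightarrow> nat" where
  "nonzeros Leaf = 0"
| "nonzeros (Node x l r) = (if x = 0 then 0 else 1) + max (nonzeros l) (nonzeros r)"

lemma finite_paths: "finite (paths t)"
  by (induction t) auto

lemma expect_mono: "(\<And>p. p \<in> paths t \<Longrightarrow> F p \<le> G p) \<Longrightarrow> expect F t \<le> expect G t"
proof (induction t arbitrary: F G)
  case (Node x l r)
  have "expect (\<lambda>p. F (x # p)) l \<le> expect (\<lambda>p. G (x # p)) l"
       "expect (\<lambda>p. F (- x # p)) r \<le> expect (\<lambda>p. G (- x # p)) r"
    using Node.prems by (auto intro!: Node.IH)
  then show ?case by simp
qed simp

lemma expect_add: "expect (\<lambda>p. F p + G p) t = expect F t + expect G t"
  by (induction t arbitrary: F G) (auto simp: field_simps)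

lemma expect_cmult: "expect (\<lambda>p. c * F p) t = c * expect F t"
  by (induction t arbitrary: F) (auto simp: field_simps)

lemma expect_const: "expect (\<lambda>_. c) t = c"
  by (induction t) auto

lemma expect_diff: "expect (\<lambda>p. F p - G p) t = expect F t - expect G t"
  using expect_add[of F "\<lambda>p. (-1) * G p" t] by (simp add: expect_cmult[of "-1", simplified])

lemma expect_nonneg: "(\<And>p. 0 \<le> F p) \<Longrightarrow> 0 \<le> expect F t"
  using expect_mono[of t "\<lambda>_. 0" F] by (simp add: expect_const)

lemma expect_sum: "expect (\<lambda>p. \<Sum>i\<in>I. F i p) t = (\<Sum>i\<in>I. expect (F i) t)"
  by (induction I rule: infinite_finite_induct) (auto simp: expect_const expect_add)

lemma expect_map:
  \<comment> \<open>Oddness of \<open>f\<close> keeps the two branches opposite after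
    mapping.\<close>
  fixes f :: "'a::uminus \<Rightarrow> 'b::uminus"
  assumes "\<And>x. f (- x) = - f x"
  shows "expect F (map_mtree f t) = expect (\<lambda>p. F (map f p)) t"
  by (induction t arbitrary: F) (auto simp: assms)

section \<open>Stopping at a budget\<close>

text \<open>The parameter \<open>L\<close> is the budget that is left for the weights.\<close>

fun stop_path :: "('a \<Rightarrow> real) \<Rightarrow> real \<Rightarrow> 'a list \<Rightarrow> 'a list" where
  "stop_path w L [] = []"
| "stop_path w L (x # p) = (if w x \<le> L then x # stop_path w (L - w x) p else [])"

fun stop_tree :: "('a \<Rightarrow> real) \<Rightarrow> real \<Rightarrow> 'a mtree \<Rightarrow> 'a mtree" where
  "stop_tree w L Leaf = Leaf"
| "stop_tree w L (Node x l r) =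
     (if w x \<le> L then Node x (stop_tree w (L - w x) l) (stop_tree w (L - w x) r) else Leaf)"

text \<open>The test at a node sees only \<open>w x = w (- x)\<close>, so it is made before the sign
  is known; stopping the tree and stopping each path therefore agree.\<close>

lemma expect_stop_tree:
  assumes "\<And>x. w (- x) = w x"
  shows "expect F (stop_tree w L t) = expect (\<lambda>p. F (stop_path w L p)) t"
  by (induction t arbitrary: F L) (auto simp: assms expect_const)

lemma paths_stop_tree_le:
  assumes "\<And>x. w (- x) = w x" "\<And>x. 0 \<le> w x"
    and "p \<in> paths (stop_tree w L t)" "x \<in> set p"
  shows "w x \<le> L"
  using assms(3,4)
proof (induction t arbitrary: p L)
  case (Node y l r)
  then have "w x \<le> L - w y" if "x \<noteq> y" "x \<noteq> - y"
    using that by (auto split: if_splits)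
  then show ?case
    using Node.prems assms(1) assms(2)[of y] by (force split: if_splits)
qed simp

lemma sum_stop_path_le:
  assumes "\<And>x. 0 \<le> w x" "0 \<le> L"
  shows "(\<Sum>x\<leftarrow>stop_path w L p. w x) \<le> min (\<Sum>x\<leftarrow>p. w x) L"
  using assms(2)
proof (induction p arbitrary: L)
  case (Cons x p)
  have "0 \<le> (\<Sum>x\<leftarrow>p. w x)"
    by (rule sum_list_nonneg) (auto simp: assms)
  then show ?case
    using Cons.IH[of "L - w x"] Cons.prems assms(1)[of x] by auto
qed simp

lemma stop_path_id:
  assumes "\<And>x. 0 \<le> w x" "(\<Sum>x\<leftarrow>p. w x) \<le> L"
  shows "stop_path w L p = p"
  using assms(2)
proof (induction p arbitrary: L)
  case (Cons x p)
  have "0 \<le> (\<Sum>x\<leftarrow>p. w x)"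
    by (rule sum_list_nonneg) (auto simp: assms)
  then show ?case
    using Cons.IH[of "L - w x"] Cons.prems by auto
qed simp

text \<open>Counting: every increment kept by \<open>P\<close> spends at least \<open>b\<close> of
  the budget \<open>L\<close>, so a path of the stopped tree contains at most \<open>L / b\<close>
  of them.\<close>

lemma nonzeros_select_stop_tree:
  fixes t :: "'a::zero mtree"
  assumes "\<And>x. 0 \<le> w x" "\<And>x. P x \<Longrightarrow> b \<le> w x" "0 \<le> b" "0 \<le> L"
  shows "real (nonzeros (map_mtree (\<lambda>x. if P x then x else 0) (stop_tree w L t))) * b \<le> L"
  using assms(4)
proof (induction t arbitrary: L)
  case (Node x l r)
  show ?case
  proof (cases "w x \<le> L")
    case True
    let ?n = "\<lambda>t. real (nonzeros (map_mtree (\<lambda>x. if P x then x else 0) (stop_tree w (L - w x) t)))"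
    have "max (?n l) (?n r) * b \<le> L - w x"
      using Node.IH[of "L - w x"] True by (simp add: max_def)
    moreover have "(if P x \<and> x \<noteq> 0 then 1 else 0) * b \<le> w x"
      using assms(1,2)[of x] by auto
    ultimately have "((if P x \<and> x \<noteq> 0 then 1 else 0) + max (?n l) (?n r)) * b \<le> L"
      by (simp only: distrib_right)
    then show ?thesis
      using True by (auto simp: of_nat_max split: if_splits)
  qed (use Node.prems in auto)
qed (use assms in auto)

section \<open>Removing zero increments\<close>

fun zero_tree :: "nat \<Rightarrow> 'a::zero mtree" where
  "zero_tree 0 = Leaf"
| "zero_tree (Suc n) = Node 0 (zero_tree n) (zero_tree n)"

lemma complete_zero_tree: "complete_tree n (zero_tree n)"
  by (induction n) auto

text \<open>Subtracting \<open>K\<close> times the sum of squares puts both sides of the desired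
  inequality into one functional, so a choice between subtrees needs to compare only one number. The
  starting value \<open>y\<close> is arbitrary because it absorbs the increments already
  passed.\<close>

lemma compress_tree:
  fixes T :: "'a::real_normed_vector \<Rightarrow> 'b::real_normed_vector" and K :: real
  defines "\<Phi> \<equiv> \<lambda>y p. (norm (y + (\<Sum>x\<leftarrow>p. T x)))\<^sup>2 - K * (\<Sum>x\<leftarrow>p. (norm x)\<^sup>2)"
  assumes "linear T" "nonzeros t \<le> n"
  shows "\<exists>t'. complete_tree n t' \<and> expect (\<Phi> y) t \<le> expect (\<Phi> y) t'"
proof -
  have T: "T 0 = 0" "\<And>x. T (- x) = - T x"
    using assms(2) by (auto simp: linear_0 linear_neg)
  have Cons: "\<Phi> y (x # p) = \<Phi> (y + T x) p + (- K * (norm x)\<^sup>2)" for x y p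
    by (simp add: \<Phi>_def algebra_simps)
  have exp_Node: "expect (\<Phi> y) (Node x l r)
      = (expect (\<Phi> (y + T x)) l + expect (\<Phi> (y - T x)) r) / 2 - K * (norm x)\<^sup>2" for x y l r
    unfolding expect.simps Cons expect_add expect_const by (simp add: T field_simps)
  \<comment> \<open>Zero increments change neither the sum nor the penalty, so padding a leaf to
    full depth is free.\<close>
  have zero: "expect (\<Phi> y) (zero_tree m) = \<Phi> y []" for y m
    by (induction m) (auto simp: exp_Node T simp del: expect.simps(2))
  show ?thesis
    using assms(3)
  proof (induction t arbitrary: n y)
    case Leaf
    then show ?case
      using complete_zero_tree[of n] zero by (intro exI[of _ "zero_tree n"]) simp
  next
    case (Node x l r)
    show ?case
    proof (cases "x = 0")
      case True
      obtain l' r' where *: "complete_tree n l'" "expect (\<Phi> y) l \<le> expect (\<Phi> y) l'"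
          "complete_tree n r'" "expect (\<Phi> y) r \<le> expect (\<Phi> y) r'"
        using Node.IH[of n y] Node.prems True by auto
      \<comment> \<open>Both children start from the same \<open>y\<close>, so the expectation is
        the average of theirs; the better child alone dominates it and no level is spent.\<close>
      have "expect (\<Phi> y) (Node x l r) \<le> max (expect (\<Phi> y) l') (expect (\<Phi> y) r')"
        using * True unfolding exp_Node by (simp add: T max_def field_simps)
      then show ?thesis
        using * by (metis max_def)
    next
      case False
      then obtain m where m: "n = Suc m" "nonzeros l \<le> m" "nonzeros r \<le> m"
        using Node.prems by (cases n) auto
      obtain l' r' where *: "complete_tree m l'" "expect (\<Phi> (y + T x)) l \<le> expect (\<Phi> (y + T x)) l'"
          "complete_tree m r'" "expect (\<Phi> (y - T x)) r \<le> expect (\<Phi> (y - T x)) r'"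
        using Node.IH(1)[OF m(2)] Node.IH(2)[OF m(3)] by metis
      show ?thesis
        by (rule exI[of _ "Node x l' r'"])
          (use * m(1) in \<open>auto simp: exp_Node simp del: expect.simps\<close>)
    qed
  qed
qed

section \<open>Dyadic estimates\<close>

text \<open>On either side of \<open>M\<close> the exponents are distinct, so each half is dominated
  by a full geometric series. The bound does not depend on \<open>F\<close>.\<close>

lemma sum_power_nat_abs_diff_le:
  fixes q :: real and F :: "int set"
  assumes "0 \<le> q" "q < 1" "finite F"
  shows "(\<Sum>m\<in>F. q ^ nat \<bar>m - M\<bar>) \<le> 2 / (1 - q)"
proof -
  have geom: "(\<Sum>m\<in>A. q ^ g m) \<le> 1 / (1 - q)" if "finite A" "inj_on g A" for A :: "int set" and g
  proof -
    have "(\<Sum>m\<in>A. q ^ g m) = (\<Sum>k\<in>g ` A. q ^ k)"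
      using that by (simp add: sum.reindex)
    also have "\<dots> \<le> (\<Sum>k. q ^ k)"
      using assms that by (intro sum_le_suminf) (auto intro: summable_geometric)
    finally show ?thesis
      using assms by (simp add: suminf_geometric)
  qed
  have "(\<Sum>m\<in>F. q ^ nat \<bar>m - M\<bar>)
      = (\<Sum>m\<in>{m\<in>F. m \<le> M}. q ^ nat \<bar>m - M\<bar>) + (\<Sum>m\<in>{m\<in>F. \<not> m \<le> M}. q ^ nat \<bar>m - M\<bar>)"
    using assms(3) by (subst sum.union_disjoint[symmetric]) (auto intro!: sum.cong)
  also have "\<dots> \<le> 1 / (1 - q) + 1 / (1 - q)"
    using assms(3) by (intro add_mono geom) (auto simp: inj_on_def)
  finally show ?thesis by simp
qed

lemma powr_floor_log_bounds:
  fixes b :: real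
  assumes "0 < b"
  shows "2 powr of_int \<lfloor>log 2 b\<rfloor> \<le> b" "b < 2 * 2 powr of_int \<lfloor>log 2 b\<rfloor>"
proof -
  show "2 powr of_int \<lfloor>log 2 b\<rfloor> \<le> b"
    using assms by (simp add: powr_le_iff)
  have "b < 2 powr (of_int \<lfloor>log 2 b\<rfloor> + 1)"
    using assms by (simp add: less_powr_iff)
  then show "b < 2 * 2 powr of_int \<lfloor>log 2 b\<rfloor>"
    by (simp add: powr_add)
qed

lemma powr_mult_of_int_abs:
  fixes a :: real
  shows "(2 powr - a) ^ nat \<bar>m - M\<bar> = 2 powr (- a * \<bar>of_int m - of_int M\<bar>)"
  by (simp add: powr_realpow[symmetric] powr_powr)

text \<open>The largest admissible power of two is comparable with \<open>l\<close>, and below it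
  the terms decay geometrically with ratio \<open>2 powr - a\<close>.\<close>

lemma sum_powr_ratio_le:
  fixes l a :: real
  assumes "0 < l" "0 < a" "finite I" "\<And>i. i \<in> I \<Longrightarrow> 2 powr of_int i \<le> l"
  shows "(\<Sum>i\<in>I. (2 powr of_int i / l) powr a) \<le> 2 / (1 - 2 powr - a)"
proof -
  define M where "M = \<lfloor>log 2 l\<rfloor>"
  have M: "2 powr of_int M \<le> l"
    using powr_floor_log_bounds assms(1) by (simp add: M_def)
  have "(2 powr of_int i / l) powr a \<le> (2 powr - a) ^ nat \<bar>i - M\<bar>" if "i \<in> I" for i
  proof -
    have "of_int i \<le> log 2 l"
      using assms(1,4) that by (simp add: le_log_iff)
    then have "i \<le> M"
      by (simp add: M_def le_floor_iff)
    have "2 powr of_int i / l \<le> 2 powr of_int i / 2 powr of_int M"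
      using M assms(1) by (intro divide_left_mono) auto
    also have "\<dots> = 2 powr (of_int i - of_int M)"
      by (simp add: powr_diff)
    finally have "(2 powr of_int i / l) powr a \<le> (2 powr (of_int i - of_int M)) powr a"
      using assms by (intro powr_mono2) auto
    also have "\<dots> = (2 powr - a) ^ nat \<bar>i - M\<bar>"
      using \<open>i \<le> M\<close> unfolding powr_mult_of_int_abs by (simp add: powr_powr algebra_simps)
    finally show ?thesis .
  qed
  then have "(\<Sum>i\<in>I. (2 powr of_int i / l) powr a) \<le> (\<Sum>i\<in>I. (2 powr - a) ^ nat \<bar>i - M\<bar>)"
    by (rule sum_mono)
  also have "\<dots> \<le> 2 / (1 - 2 powr - a)"
    using assms by (intro sum_power_nat_abs_diff_le) (auto simp: powr_minus_divide)
  finally show ?thesis .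
qed

text \<open>A discrete form of integrating over all levels \<open>l\<close>. For
  \<open>l powr s\<close> below \<open>A\<close> the term is \<open>l powr r\<close>, above it is
  \<open>A * l powr (r - s)\<close>; both decay geometrically away from the crossover, where the
  size is \<open>A powr (r / s)\<close>.\<close>

lemma sum_powr_min_le:
  fixes r s :: real
  assumes "0 < r" "r < s"
  obtains C where "0 \<le> C"
    "\<And>F A. finite F \<Longrightarrow> 0 \<le> A \<Longrightarrow>
      (\<Sum>m\<in>F. (2 powr of_int m) powr (r - s) * min A ((2 powr of_int m) powr s)) \<le> C * A powr (r / s)"
proof -
  \<comment> \<open>The slower of the two decay rates, \<open>r\<close> below and
    \<open>s - r\<close> above the crossover.\<close>
  define a where "a = min r (s - r)"
  have a: "0 < a" "a \<le> r" "a \<le> s - r" using assms by (auto simp: a_def)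
  define q :: real where "q = 2 powr - a"
  have q: "0 \<le> q" "q < 1" using a by (auto simp: q_def powr_minus_divide)
  show thesis
  proof
    show "0 \<le> 2 powr s * (2 / (1 - q))"
      using q by simp
    fix F :: "int set" and A :: real
    assume F: "finite F" and A: "0 \<le> A"
    show "(\<Sum>m\<in>F. (2 powr of_int m) powr (r - s) * min A ((2 powr of_int m) powr s))
        \<le> 2 powr s * (2 / (1 - q)) * A powr (r / s)"
    proof (cases "A = 0")
      case True
      then show ?thesis by simp
    next
      case False
      \<comment> \<open>The crossover level, later rounded down to
        \<open>2 powr of_int M\<close>.\<close>
      define b where "b = A powr (1 / s)"
      have b: "0 < b" "A = b powr s" "A powr (r / s) = b powr r"
        using False A assms by (auto simp: b_def powr_powr)
      define M where "M = \<lfloor>log 2 b\<rfloor>"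
      have M: "2 powr of_int M \<le> b" "b < 2 * 2 powr of_int M"
        using powr_floor_log_bounds[OF b(1)] by (auto simp: M_def)
      have "(2 powr of_int m) powr (r - s) * min A ((2 powr of_int m) powr s)
          \<le> 2 powr s * b powr r * q ^ nat \<bar>m - M\<bar>" for m :: int
      proof -
        have Mr: "2 powr (of_int M * r) \<le> b powr r"
          using powr_mono2[of r "2 powr of_int M" b] M assms by (simp add: powr_powr)
        \<comment> \<open>Rounding \<open>b\<close> loses less than a factor 2, which costs
          \<open>2 powr s\<close>.\<close>
        have "A \<le> (2 * 2 powr of_int M) powr s"
          unfolding b(2) using M b assms by (intro powr_mono2) auto
        then have As: "A \<le> 2 powr s * 2 powr (of_int M * s)"
          by (simp add: powr_mult powr_powr)
        have "(2 powr of_int m) powr (r - s) * min A ((2 powr of_int m) powr s)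
            \<le> 2 powr s * 2 powr (of_int M * r) * 2 powr (- a * \<bar>of_int m - of_int M\<bar>)"
        proof (cases "m \<le> M")
          case True
          have "(2 powr of_int m) powr (r - s) * min A ((2 powr of_int m) powr s)
              \<le> (2 powr of_int m) powr (r - s) * (2 powr of_int m) powr s"
            by (intro mult_left_mono) auto
          also have "\<dots> = 2 powr (of_int M * r) * 2 powr (r * (of_int m - of_int M))"
            by (simp add: powr_powr flip: powr_add) (simp add: algebra_simps)
          also have "\<dots> \<le> 2 powr (of_int M * r) * 2 powr (a * (of_int m - of_int M))"
            using True a by (intro mult_left_mono powr_mono mult_right_mono_neg) auto
          also have "\<dots> \<le> 2 powr s * (2 powr (of_int M * r) * 2 powr (a * (of_int m - of_int M)))"
            using ge_one_powr_ge_zero[of 2 s] assms by (simp add: mult_le_cancel_right1 not_less)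
          finally show ?thesis
            using True by (simp add: algebra_simps)
        next
          case False
          have "(2 powr of_int m) powr (r - s) * min A ((2 powr of_int m) powr s)
              \<le> (2 powr of_int m) powr (r - s) * (2 powr s * 2 powr (of_int M * s))"
            using As by (intro mult_left_mono) auto
          also have "\<dots> = 2 powr s * 2 powr (of_int M * r) * 2 powr (- (s - r) * (of_int m - of_int M))"
            by (simp add: powr_powr flip: powr_add) (simp add: algebra_simps)
          also have "\<dots> \<le> 2 powr s * 2 powr (of_int M * r) * 2 powr (- a * (of_int m - of_int M))"
            using False a by (intro mult_left_mono powr_mono mult_right_mono) auto
          finally show ?thesis
            using False by simp
        qed
        also have "\<dots> \<le> 2 powr s * b powr r * 2 powr (- a * \<bar>of_int m - of_int M\<bar>)"
          using Mr by (intro mult_right_mono mult_left_mono) auto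
        finally show ?thesis
          by (simp add: q_def powr_mult_of_int_abs)
      qed
      then have "(\<Sum>m\<in>F. (2 powr of_int m) powr (r - s) * min A ((2 powr of_int m) powr s))
          \<le> 2 powr s * b powr r * (\<Sum>m\<in>F. q ^ nat \<bar>m - M\<bar>)"
        unfolding sum_distrib_left by (rule sum_mono)
      also have "\<dots> \<le> 2 powr s * b powr r * (2 / (1 - q))"
        using sum_power_nat_abs_diff_le[OF q F, of M] by (intro mult_left_mono) auto
      finally show ?thesis
        using b by (simp add: mult_ac)
    qed
  qed
qed

section \<open>Inequalities for powers and for squares of sums\<close>

lemma powr_add_le_add_powr:
  fixes a b \<theta> :: real
  assumes "0 \<le> a" "0 \<le> b" "0 < \<theta>" "\<theta> \<le> 1"
  shows "(a + b) powr \<theta> \<le> a powr \<theta> + b powr \<theta>"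
proof (cases "a + b = 0")
  case False
  then have "0 < a + b" using assms by simp
  \<comment> \<open>A proportion lies in the unit interval, where an exponent of at most 1 can only
    increase it; the two proportions add up to 1.\<close>
  then have *: "x / (a + b) \<le> (x / (a + b)) powr \<theta>" if "0 \<le> x" "x \<le> a + b" for x
    using powr_mono'[of \<theta> 1 "x / (a + b)"] that assms by (auto simp: divide_le_eq_1)
  have "1 \<le> (a / (a + b)) powr \<theta> + (b / (a + b)) powr \<theta>"
  proof -
    have "a / (a + b) + b / (a + b) = 1"
      using False by (simp add: add_divide_distrib[symmetric])
    then show ?thesis
      using *[of a] *[of b] assms by linarith
  qed
  then have "(a + b) powr \<theta> * 1 \<le> (a + b) powr \<theta> * ((a / (a + b)) powr \<theta> + (b / (a + b)) powr \<theta>)"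
    by (rule mult_left_mono) simp
  then show ?thesis
    using assms False by (simp add: distrib_left powr_divide)
qed (use assms in auto)

text \<open>The contractive inclusion of \<open>l_r\<close> in \<open>l_s\<close>, obtained from
  subadditivity of the power \<open>r / s\<close>.\<close>

lemma sum_list_powr_le:
  fixes p :: "'a::real_normed_vector list"
  assumes "0 < r" "r \<le> s"
  shows "(\<Sum>x\<leftarrow>p. norm x powr s) powr (r / s) \<le> (\<Sum>x\<leftarrow>p. norm x powr r)"
proof (induction p)
  case (Cons x p)
  have "0 \<le> (\<Sum>x\<leftarrow>p. norm x powr s)"
    by (rule sum_list_nonneg) auto
  then have "(\<Sum>x\<leftarrow>x # p. norm x powr s) powr (r / s)
      \<le> (norm x powr s) powr (r / s) + (\<Sum>x\<leftarrow>p. norm x powr s) powr (r / s)"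
    using assms by (simp only: list.map sum_list.Cons) (intro powr_add_le_add_powr, auto)
  also have "\<dots> \<le> norm x powr r + (\<Sum>x\<leftarrow>p. norm x powr r)"
    using Cons assms by (simp add: powr_powr)
  finally show ?case by simp
qed simp

text \<open>Cauchy-Schwarz after writing each norm as \<open>sqrt (w i)\<close> times its quotient
  by \<open>sqrt (w i)\<close>. Suitable weights avoid a factor counting the summands.\<close>

lemma norm_sum_squared_le_weighted:
  fixes u :: "'i \<Rightarrow> 'b::real_normed_vector"
  assumes "\<And>i. i \<in> I \<Longrightarrow> 0 < w i"
  shows "(norm (\<Sum>i\<in>I. u i))\<^sup>2 \<le> (\<Sum>i\<in>I. w i) * (\<Sum>i\<in>I. (norm (u i))\<^sup>2 / w i)"
proof -
  have "(norm (\<Sum>i\<in>I. u i))\<^sup>2 \<le> (\<Sum>i\<in>I. norm (u i))\<^sup>2"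
    by (intro power_mono norm_sum) auto
  also have "(\<Sum>i\<in>I. norm (u i)) = (\<Sum>i\<in>I. sqrt (w i) * (norm (u i) / sqrt (w i)))"
    using assms by (intro sum.cong) (auto simp: less_le)
  also have "\<dots>\<^sup>2 \<le> (\<Sum>i\<in>I. (sqrt (w i))\<^sup>2) * (\<Sum>i\<in>I. (norm (u i) / sqrt (w i))\<^sup>2)"
    by (rule Cauchy_Schwarz_ineq_sum)
  also have "\<dots> = (\<Sum>i\<in>I. w i) * (\<Sum>i\<in>I. (norm (u i))\<^sup>2 / w i)"
    using assms by (intro arg_cong2[of _ _ _ _ "(*)"] sum.cong) (auto simp: power_divide less_imp_le)
  finally show ?thesis .
qed

section \<open>Extrapolation on trees\<close>

text \<open>For complete trees the hypothesis says that the penalised functional of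
  \<open>compress_tree\<close>, with start 0 and penalty \<open>K * real n powr \<gamma>\<close>,
  has expectation at most 0. Compression carries this over to \<open>t\<close>.\<close>

lemma expect_square_le_nonzeros:
  fixes T :: "'a::real_normed_vector \<Rightarrow> 'b::real_normed_vector"
  assumes "linear T"
    and "\<And>n t. complete_tree n t \<Longrightarrow>
      expect (\<lambda>p. (norm (\<Sum>x\<leftarrow>p. T x))\<^sup>2) t \<le> K * real n powr \<gamma> * expect (\<lambda>p. \<Sum>x\<leftarrow>p. (norm x)\<^sup>2) t"
  shows "expect (\<lambda>p. (norm (\<Sum>x\<leftarrow>p. T x))\<^sup>2) t
    \<le> K * real (nonzeros t) powr \<gamma> * expect (\<lambda>p. \<Sum>x\<leftarrow>p. (norm x)\<^sup>2) t"
proof -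
  obtain t' where t': "complete_tree (nonzeros t) t'"
    "expect (\<lambda>p. (norm (0 + (\<Sum>x\<leftarrow>p. T x)))\<^sup>2 - K * real (nonzeros t) powr \<gamma> * (\<Sum>x\<leftarrow>p. (norm x)\<^sup>2)) t
     \<le> expect (\<lambda>p. (norm (0 + (\<Sum>x\<leftarrow>p. T x)))\<^sup>2 - K * real (nonzeros t) powr \<gamma> * (\<Sum>x\<leftarrow>p. (norm x)\<^sup>2)) t'"
    using compress_tree[OF assms(1) order_refl] by blast
  then show ?thesis
    using assms(2)[OF t'(1)] by (simp add: expect_diff expect_cmult)
qed

text \<open>The increments are sorted by dyadic size. Stopping limits how many of each size a path
  contains, so each class obeys the bound by number of nonzero increments. In the application
  \<open>\<gamma> + 1 = 2 / p\<close>, and \<open>s * (\<gamma> + 1) < 2\<close> means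
  \<open>s < p\<close>.\<close>

lemma expect_square_stopped_le:
  fixes T :: "'a::real_normed_vector \<Rightarrow> 'b::real_normed_vector"
  assumes "linear T" "0 \<le> K" "0 \<le> \<gamma>" "0 < s" "s * (\<gamma> + 1) < 2"
    and hyp: "\<And>n t. complete_tree n t \<Longrightarrow>
      expect (\<lambda>p. (norm (\<Sum>x\<leftarrow>p. T x))\<^sup>2) t \<le> K * real n powr \<gamma> * expect (\<lambda>p. \<Sum>x\<leftarrow>p. (norm x)\<^sup>2) t"
    and l: "0 < l"
  defines "w \<equiv> \<lambda>x::'a. norm x powr s"
  shows "expect (\<lambda>p. (norm (\<Sum>x\<leftarrow>p. T x))\<^sup>2) (stop_tree w (l powr s) t)
    \<le> 2 / (1 - 2 powr - (2 - s * (\<gamma> + 1))) * (K * 2 powr (2 - s)) * l powr (2 - s)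
      * expect (\<lambda>p. \<Sum>x\<leftarrow>p. w x) (stop_tree w (l powr s) t)"
proof -
  \<comment> \<open>For the class of size \<open>z\<close> the bound scales like
    \<open>(z / l) powr e\<close>; positivity of \<open>e\<close> makes the small sizes
    summable.\<close>
  define e where "e = 2 - s * (\<gamma> + 1)"
  have e: "0 < e" using assms by (simp add: e_def)
  have "s < 2" using assms(5) mult_nonneg_nonneg[OF less_imp_le[OF assms(4)] assms(3)] by (simp only: distrib_left)
  define t' where "t' = stop_tree w (l powr s) t"
  have w: "0 \<le> w x" "w (- x) = w x" for x by (auto simp: w_def)
  define b where "b = (\<lambda>x::'a. \<lfloor>log 2 (norm x)\<rfloor>)"
  define P where "P = (\<lambda>i x. x \<noteq> 0 \<and> b x = i)"
  define f where "f = (\<lambda>i x. if P i x then x else 0)"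
  \<comment> \<open>Only the sizes that occur, hence finitely many. Zero is left out because its
    logarithm is a mere default value.\<close>
  define I where "I = b ` ((\<Union>p\<in>paths t'. set p) - {0})"
  define u where "u = (\<lambda>i p. \<Sum>x\<leftarrow>p. T (f i x))"
  define h where "h = (\<lambda>i p. \<Sum>x\<leftarrow>p. if P i x then w x else 0)"
  \<comment> \<open>the Cauchy-Schwarz weight that makes each bound in \<open>piece\<close> independent of \<open>i\<close>\<close>
  define W where "W = (\<lambda>i::int. (2 powr of_int i / l) powr e)"
  define D where "D = K * 2 powr (2 - s) * l powr (2 - s)"
  have D: "0 \<le> D" using assms by (simp add: D_def)
  \<comment> \<open>Selection depends on the norm alone, so it is odd, as \<open>expect_map\<close>
    demands.\<close>
  have f_minus: "f i (- x) = - f i x" for i x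
    by (simp add: f_def P_def b_def)
  have T0: "T 0 = 0" using assms(1) by (rule linear_0)
  have finI: "finite I"
    by (simp add: I_def finite_paths)
  have Wpos: "0 < W i" for i
    using l by (simp add: W_def)
  have I_le: "2 powr of_int i \<le> l" if i: "i \<in> I" for i
  proof -
    obtain p x where x: "p \<in> paths t'" "x \<in> set p" "x \<noteq> 0" "i = b x"
      using i by (auto simp: I_def)
    have "w x \<le> l powr s"
      using paths_stop_tree_le[of w p "l powr s" t x] x w by (auto simp: t'_def)
    then have "norm x \<le> l"
      using assms(4) l powr_less_mono2[of s l "norm x"] by (auto simp: w_def not_less[symmetric])
    then show ?thesis
      using powr_floor_log_bounds(1)[of "norm x"] x by (simp add: b_def)
  qed
  have T_split: "T x = (\<Sum>i\<in>I. T (f i x))" if "p \<in> paths t'" "x \<in> set p" for p x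
  proof (cases "x = 0")
    case False
    then have "b x \<in> I"
      using that by (auto simp: I_def)
    have "(\<Sum>i\<in>I. T (f i x)) = (\<Sum>i\<in>I. if i = b x then T x else 0)"
      using False by (intro sum.cong) (auto simp: f_def P_def T0)
    then show ?thesis
      using \<open>b x \<in> I\<close> finI by simp
  qed (simp add: f_def T0)
  have split: "(\<Sum>x\<leftarrow>p. T x) = (\<Sum>i\<in>I. u i p)" if "p \<in> paths t'" for p
  proof -
    have "(\<Sum>x\<leftarrow>p. T x) = (\<Sum>x\<leftarrow>p. \<Sum>i\<in>I. T (f i x))"
      using T_split[OF that] by (intro arg_cong[of _ _ sum_list] map_cong) auto
    also have "\<dots> = (\<Sum>i\<in>I. u i p)"
      unfolding u_def by (induction p) (auto simp: sum.distrib)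
    finally show ?thesis .
  qed
  have h_le: "(\<Sum>i\<in>I. h i p) \<le> (\<Sum>x\<leftarrow>p. w x)" for p
  proof -
    have "(\<Sum>i\<in>I. h i p) = (\<Sum>x\<leftarrow>p. \<Sum>i\<in>I. if P i x then w x else 0)"
      unfolding h_def by (induction p) (auto simp: sum.distrib)
    also have "\<dots> \<le> (\<Sum>x\<leftarrow>p. w x)"
    proof (rule sum_list_mono)
      fix x
      have "(\<Sum>i\<in>I. if P i x then w x else 0) \<le> (\<Sum>i\<in>I. if i = b x then w x else 0)"
        by (intro sum_mono) (auto simp: P_def w)
      also have "\<dots> \<le> w x" using finI w by simp
      finally show "(\<Sum>i\<in>I. if P i x then w x else 0) \<le> w x" .
    qed
    finally show ?thesis .
  qed
  have piece: "expect (\<lambda>p. (norm (u i p))\<^sup>2) t' \<le> W i * (D * expect (h i) t')" for i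
  proof -
    define z :: real where "z = 2 powr of_int i"
    have z: "0 < z" by (simp add: z_def)
    define N where "N = nonzeros (map_mtree (f i) t')"
    have Px: "z \<le> norm x" "norm x \<le> 2 * z" if "P i x" for x
      using that powr_floor_log_bounds[of "norm x"] by (auto simp: P_def b_def z_def)
    \<comment> \<open>Each selected increment has weight at least \<open>z powr s\<close>, and the
      budget is \<open>l powr s\<close>.\<close>
    have "real N * z powr s \<le> l powr s"
      unfolding N_def f_def t'_def
      by (rule nonzeros_select_stop_tree) (use Px z assms(4) in \<open>auto simp: w_def intro!: powr_mono2\<close>)
    then have "real N \<le> (l / z) powr s"
      using z l by (simp add: powr_divide field_simps)
    then have "real N powr \<gamma> \<le> ((l / z) powr s) powr \<gamma>"
      using assms(3) by (intro powr_mono2) auto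
    then have N: "real N powr \<gamma> \<le> (l / z) powr (s * \<gamma>)"
      by (simp add: powr_powr)
    \<comment> \<open>Of the square, the power \<open>s\<close> is kept as weight, and the remaining
      power \<open>2 - s\<close> is estimated by the upper size bound \<open>2 * z\<close>.\<close>
    have sq: "(\<Sum>x\<leftarrow>map (f i) p. (norm x)\<^sup>2) \<le> (2 * z) powr (2 - s) * h i p" for p
    proof -
      have "(norm (f i x))\<^sup>2 \<le> (2 * z) powr (2 - s) * (if P i x then w x else 0)" for x
      proof (cases "P i x")
        case True
        then have "(norm x)\<^sup>2 = norm x powr (2 - s) * norm x powr s"
          using z Px[of x] by (simp add: powr_add[symmetric])
        also have "\<dots> \<le> (2 * z) powr (2 - s) * norm x powr s"
          using Px[OF True] \<open>s < 2\<close> by (intro mult_right_mono powr_mono2) auto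
        finally show ?thesis
          using True by (simp add: f_def w_def)
      qed (simp add: f_def)
      then show ?thesis
        unfolding h_def by (simp add: sum_list_const_mult[symmetric] o_def sum_list_mono)
    qed
    have "expect (\<lambda>p. (norm (u i p))\<^sup>2) t' = expect (\<lambda>p. (norm (\<Sum>x\<leftarrow>p. T x))\<^sup>2) (map_mtree (f i) t')"
      by (simp add: expect_map[of "f i", OF f_minus] u_def o_def)
    also have "\<dots> \<le> K * real N powr \<gamma> * expect (\<lambda>p. \<Sum>x\<leftarrow>p. (norm x)\<^sup>2) (map_mtree (f i) t')"
      unfolding N_def by (rule expect_square_le_nonzeros[OF assms(1) hyp])
    also have "\<dots> \<le> K * (l / z) powr (s * \<gamma>) * expect (\<lambda>p. \<Sum>x\<leftarrow>p. (norm x)\<^sup>2) (map_mtree (f i) t')"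
      using N assms(2) by (intro mult_right_mono mult_left_mono expect_nonneg sum_list_nonneg) auto
    also have "\<dots> \<le> K * (l / z) powr (s * \<gamma>) * ((2 * z) powr (2 - s) * expect (h i) t')"
      using sq assms(2) by (auto simp: expect_map[of "f i", OF f_minus] expect_cmult[symmetric] intro!: mult_left_mono expect_mono)
    also have "\<dots> = W i * (D * expect (h i) t')"
    proof -
      have "(l / z) powr (s * \<gamma>) * (2 * z) powr (2 - s)
          = 2 powr (2 - s) * (l powr (s * \<gamma>) * (z powr (2 - s) / z powr (s * \<gamma>)))"
        using z l by (simp add: powr_divide powr_mult)
      also have "z powr (2 - s) / z powr (s * \<gamma>) = z powr e"
        by (simp add: powr_diff[symmetric] e_def algebra_simps)
      also have "l powr (s * \<gamma>) * z powr e = l powr (2 - s) * (z powr e / l powr e)"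
      proof -
        have "s * \<gamma> = (2 - s) - e" by (simp add: e_def algebra_simps)
        then have "l powr (s * \<gamma>) = l powr (2 - s) / l powr e" by (simp only: powr_diff)
        then show ?thesis by simp
      qed
      finally have *: "(l / z) powr (s * \<gamma>) * (2 * z) powr (2 - s) = W i * (2 powr (2 - s) * l powr (2 - s))"
        using z l by (simp add: W_def z_def[symmetric] powr_divide)
      have "K * (l / z) powr (s * \<gamma>) * ((2 * z) powr (2 - s) * expect (h i) t')
          = K * ((l / z) powr (s * \<gamma>) * (2 * z) powr (2 - s)) * expect (h i) t'"
        by (simp only: mult.assoc)
      then show ?thesis
        unfolding * by (simp add: D_def)
    qed
    finally show ?thesis .
  qed
  \<comment> \<open>After division by \<open>W i\<close> the class \<open>i\<close> costs only
    \<open>D * expect (h i) t'\<close>. The classes are disjoint, so the \<open>h i\<close> add up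
    to at most the whole weight, and \<open>sum W I\<close> is a geometric sum.\<close>
  have "expect (\<lambda>p. (norm (\<Sum>x\<leftarrow>p. T x))\<^sup>2) t'
      \<le> expect (\<lambda>p. sum W I * (\<Sum>i\<in>I. (norm (u i p))\<^sup>2 / W i)) t'"
    using Wpos by (intro expect_mono) (simp add: split norm_sum_squared_le_weighted)
  also have "\<dots> = sum W I * (\<Sum>i\<in>I. expect (\<lambda>p. (norm (u i p))\<^sup>2) t' / W i)"
    by (simp add: expect_cmult expect_sum divide_inverse mult.commute[of _ "inverse _"])
  also have "\<dots> \<le> sum W I * (\<Sum>i\<in>I. D * expect (h i) t')"
    using piece Wpos by (intro mult_left_mono sum_mono sum_nonneg) (auto simp: divide_le_eq mult_ac less_imp_le)
  also have "\<dots> = sum W I * (D * expect (\<lambda>p. \<Sum>i\<in>I. h i p) t')"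
    by (simp add: expect_sum sum_distrib_left)
  also have "\<dots> \<le> sum W I * (D * expect (\<lambda>p. \<Sum>x\<leftarrow>p. w x) t')"
    using h_le Wpos D by (intro mult_left_mono expect_mono sum_nonneg) (auto simp: less_imp_le)
  also have "\<dots> \<le> 2 / (1 - 2 powr - e) * (D * expect (\<lambda>p. \<Sum>x\<leftarrow>p. w x) t')"
    unfolding W_def using l e finI I_le D w
    by (intro mult_right_mono sum_powr_ratio_le mult_nonneg_nonneg expect_nonneg sum_list_nonneg) auto
  finally show ?thesis
    by (simp add: t'_def e_def D_def mult_ac)
qed

text \<open>Paths within the budget are not stopped and fall under the stopped estimate. On the
  others the truncated square is at most \<open>l * l\<close>, which is
  \<open>l powr (2 - s)\<close> times the truncated weight; this accounts for the \<open>+ 1\<close>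
  in the constant.\<close>

lemma expect_min_square_le:
  fixes T :: "'a::real_normed_vector \<Rightarrow> 'b::real_normed_vector"
  assumes "linear T" "0 \<le> K" "0 \<le> \<gamma>" "0 < s" "s * (\<gamma> + 1) < 2"
    and hyp: "\<And>n t. complete_tree n t \<Longrightarrow>
      expect (\<lambda>p. (norm (\<Sum>x\<leftarrow>p. T x))\<^sup>2) t \<le> K * real n powr \<gamma> * expect (\<lambda>p. \<Sum>x\<leftarrow>p. (norm x)\<^sup>2) t"
  obtains C where "0 \<le> C"
    "\<And>l t. 0 < l \<Longrightarrow> expect (\<lambda>p. (min (norm (\<Sum>x\<leftarrow>p. T x)) l)\<^sup>2) t
      \<le> C * l powr (2 - s) * expect (\<lambda>p. min (\<Sum>x\<leftarrow>p. norm x powr s) (l powr s)) t"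
proof
  define C where "C = 2 / (1 - 2 powr - (2 - s * (\<gamma> + 1))) * (K * 2 powr (2 - s))"
  have "2 powr - (2 - s * (\<gamma> + 1)) \<le> 1"
    using assms(5) powr_mono[of "- (2 - s * (\<gamma> + 1))" 0 2] by simp
  then have C: "0 \<le> C"
    using assms(2) by (simp add: C_def)
  then show "0 \<le> C + 1" by simp
  fix l :: real and t :: "'a mtree"
  assume l: "0 < l"
  define w where "w = (\<lambda>x::'a. norm x powr s)"
  have w: "0 \<le> w x" "w (- x) = w x" for x by (auto simp: w_def)
  define A where "A = (\<lambda>p. \<Sum>x\<leftarrow>p. w x)"
  let ?S = "\<lambda>p. norm (\<Sum>x\<leftarrow>p. T x)"
  let ?q = "stop_path w (l powr s)"
  have pt: "(min (?S p) l)\<^sup>2 \<le> (?S (?q p))\<^sup>2 + l powr (2 - s) * min (A p) (l powr s)" for p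
  proof (cases "A p \<le> l powr s")
    case True
    then have "?q p = p"
      using w by (auto simp: A_def intro!: stop_path_id)
    moreover have "0 \<le> A p"
      using w by (auto simp: A_def intro!: sum_list_nonneg)
    moreover have "(min (?S p) l)\<^sup>2 \<le> (?S p)\<^sup>2"
      using l by (intro power_mono) auto
    ultimately show ?thesis
      by (simp add: add_increasing2)
  next
    case False
    have "(min (?S p) l)\<^sup>2 \<le> l\<^sup>2"
      using l by (intro power_mono) auto
    also have "\<dots> = l powr (2 - s) * l powr s"
      using l by (simp add: powr_add[symmetric])
    finally show ?thesis
      using False by (simp add: add_increasing)
  qed
  have "expect (\<lambda>p. (min (?S p) l)\<^sup>2) t
      \<le> expect (\<lambda>p. (?S (?q p))\<^sup>2 + l powr (2 - s) * min (A p) (l powr s)) t"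
    using pt by (rule expect_mono)
  also have "\<dots> = expect (\<lambda>p. (?S p)\<^sup>2) (stop_tree w (l powr s) t)
      + l powr (2 - s) * expect (\<lambda>p. min (A p) (l powr s)) t"
    by (simp add: expect_add expect_cmult expect_stop_tree w)
  finally have 1: "expect (\<lambda>p. (min (?S p) l)\<^sup>2) t \<le> expect (\<lambda>p. (?S p)\<^sup>2) (stop_tree w (l powr s) t)
      + l powr (2 - s) * expect (\<lambda>p. min (A p) (l powr s)) t" .
  have "expect (\<lambda>p. (?S p)\<^sup>2) (stop_tree w (l powr s) t)
      \<le> C * l powr (2 - s) * expect A (stop_tree w (l powr s) t)"
    unfolding C_def w_def A_def by (rule expect_square_stopped_le) (use assms l in auto)
  \<comment> \<open>The weight collected before stopping exceeds neither the budget nor the full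
    sum.\<close>
  also have "\<dots> \<le> C * l powr (2 - s) * expect (\<lambda>p. min (A p) (l powr s)) t"
    unfolding expect_stop_tree[of w, OF w(2)] A_def
    using C by (intro mult_left_mono expect_mono sum_stop_path_le) (auto simp: w)
  finally show "expect (\<lambda>p. (min (?S p) l)\<^sup>2) t
      \<le> (C + 1) * l powr (2 - s) * expect (\<lambda>p. min (\<Sum>x\<leftarrow>p. norm x powr s) (l powr s)) t"
    using 1 by (simp add: A_def w_def algebra_simps)
qed

text \<open>Truncated second moments at all dyadic levels \<open>l\<close>, weighted by
  \<open>l powr (r - 2)\<close>, control the moment of order \<open>r\<close>. The exponents
  \<open>r - 2\<close> and \<open>2 - s\<close> combine to the \<open>r - s\<close> of
  \<open>sum_powr_min_le\<close>.\<close>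

lemma expect_powr_le:
  fixes T :: "'a::real_normed_vector \<Rightarrow> 'b::real_normed_vector"
  assumes "linear T" "0 \<le> K" "0 \<le> \<gamma>" "0 < r" "r * (\<gamma> + 1) < 2"
    and hyp: "\<And>n t. complete_tree n t \<Longrightarrow>
      expect (\<lambda>p. (norm (\<Sum>x\<leftarrow>p. T x))\<^sup>2) t \<le> K * real n powr \<gamma> * expect (\<lambda>p. \<Sum>x\<leftarrow>p. (norm x)\<^sup>2) t"
  obtains C where "0 \<le> C"
    "\<And>t. expect (\<lambda>p. norm (\<Sum>x\<leftarrow>p. T x) powr r) t \<le> C * expect (\<lambda>p. \<Sum>x\<leftarrow>p. norm x powr r) t"
proof -
  have "r < 2 / (\<gamma> + 1)"
    using assms by (simp add: less_divide_eq)
  \<comment> \<open>Room is needed on both sides: \<open>r < s\<close> for summing over the levels,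
    \<open>s < 2 / (\<gamma> + 1)\<close> for the truncated estimate.\<close>
  then obtain s where s: "r < s" "s < 2 / (\<gamma> + 1)"
    using dense by blast
  then have s': "0 < s" "s * (\<gamma> + 1) < 2"
    using assms by (auto simp: less_divide_eq)
  have "r < 2"
    using assms(5) mult_nonneg_nonneg[OF less_imp_le[OF assms(4)] assms(3)] by (simp only: distrib_left)
  obtain C1 where C1: "0 \<le> C1"
    "\<And>l t. 0 < l \<Longrightarrow> expect (\<lambda>p. (min (norm (\<Sum>x\<leftarrow>p. T x)) l)\<^sup>2) t
      \<le> C1 * l powr (2 - s) * expect (\<lambda>p. min (\<Sum>x\<leftarrow>p. norm x powr s) (l powr s)) t"
    using expect_min_square_le[OF assms(1-3) s' hyp] by blast
  obtain C2 where C2: "0 \<le> C2"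
    "\<And>F A. finite F \<Longrightarrow> 0 \<le> A \<Longrightarrow>
      (\<Sum>m\<in>F. (2 powr of_int m) powr (r - s) * min A ((2 powr of_int m) powr s)) \<le> C2 * A powr (r / s)"
    using sum_powr_min_le[OF assms(4) s(1)] by blast
  show thesis
  proof
    show "0 \<le> 4 * C1 * C2" using C1 C2 by simp
    fix t :: "'a mtree"
    let ?S = "\<lambda>p. norm (\<Sum>x\<leftarrow>p. T x)"
    let ?A = "\<lambda>p. \<Sum>x\<leftarrow>p. norm (x::'a) powr s"
    let ?z = "\<lambda>m::int. 2 powr of_int m :: real"
    \<comment> \<open>Only the levels met by the paths of \<open>t\<close>. This set depends on
      \<open>t\<close>, but \<open>C2\<close> does not depend on the set.\<close>
    define F where "F = (\<lambda>p. \<lfloor>log 2 (?S p)\<rfloor>) ` paths t"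
    have F: "finite F" by (simp add: F_def finite_paths)
    \<comment> \<open>The single level just below the norm suffices; rounding costs
      \<open>2 powr r\<close>, which is below 4.\<close>
    have pt: "?S p powr r \<le> 4 * (\<Sum>m\<in>F. ?z m powr (r - 2) * (min (?S p) (?z m))\<^sup>2)" if "p \<in> paths t" for p
    proof (cases "?S p = 0")
      case False
      define m where "m = \<lfloor>log 2 (?S p)\<rfloor>"
      have m: "?z m \<le> ?S p" "?S p \<le> 2 * ?z m"
        using powr_floor_log_bounds[of "?S p"] False by (auto simp: m_def)
      have "?S p powr r \<le> (2 * ?z m) powr r"
        using m assms(4) by (intro powr_mono2) auto
      also have "\<dots> = 2 powr r * ?z m powr r"
        by (simp add: powr_mult)
      also have "\<dots> \<le> 2 powr 2 * ?z m powr r"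
        using \<open>r < 2\<close> by (intro mult_right_mono powr_mono) auto
      also have "?z m powr r = ?z m powr (r - 2) * (?z m powr 2)"
        by (simp only: powr_add[symmetric] diff_add_cancel)
      also have "\<dots> = ?z m powr (r - 2) * (min (?S p) (?z m))\<^sup>2"
        using m by (simp add: min_absorb2)
      also have "\<dots> \<le> (\<Sum>m\<in>F. ?z m powr (r - 2) * (min (?S p) (?z m))\<^sup>2)"
        using F that by (intro member_le_sum) (auto simp: F_def m_def)
      finally show ?thesis by simp
    qed (simp add: sum_nonneg)
    have "expect (\<lambda>p. ?S p powr r) t
        \<le> expect (\<lambda>p. 4 * (\<Sum>m\<in>F. ?z m powr (r - 2) * (min (?S p) (?z m))\<^sup>2)) t"
      by (intro expect_mono pt)
    also have "\<dots> = 4 * (\<Sum>m\<in>F. ?z m powr (r - 2) * expect (\<lambda>p. (min (?S p) (?z m))\<^sup>2) t)"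
      by (simp add: expect_cmult expect_sum)
    also have "\<dots> \<le> 4 * (\<Sum>m\<in>F. ?z m powr (r - 2)
        * (C1 * ?z m powr (2 - s) * expect (\<lambda>p. min (?A p) (?z m powr s)) t))"
      by (intro mult_left_mono sum_mono C1(2)) auto
    also have "\<dots> = 4 * (\<Sum>m\<in>F. C1 * (?z m powr (r - s) * expect (\<lambda>p. min (?A p) (?z m powr s)) t))"
    proof -
      have "?z m powr (r - 2) * (C1 * ?z m powr (2 - s) * E) = C1 * (?z m powr (r - s) * E)" for m :: int and E
        using powr_add[of "?z m" "r - 2" "2 - s"] by simp
      then show ?thesis by (simp only:)
    qed
    also have "\<dots> = 4 * C1 * expect (\<lambda>p. \<Sum>m\<in>F. ?z m powr (r - s) * min (?A p) (?z m powr s)) t"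
      by (simp add: expect_cmult expect_sum sum_distrib_left mult.assoc)
    also have "\<dots> \<le> 4 * C1 * expect (\<lambda>p. C2 * ?A p powr (r / s)) t"
      using C1(1) F by (intro mult_left_mono expect_mono C2(2) sum_list_nonneg) auto
    also have "\<dots> = 4 * C1 * C2 * expect (\<lambda>p. ?A p powr (r / s)) t"
      by (simp add: expect_cmult)
    also have "\<dots> \<le> 4 * C1 * C2 * expect (\<lambda>p. \<Sum>x\<leftarrow>p. norm x powr r) t"
      using C1 C2 assms(4) s by (intro mult_left_mono expect_mono sum_list_powr_le) auto
    finally show "expect (\<lambda>p. ?S p powr r) t \<le> 4 * C1 * C2 * expect (\<lambda>p. \<Sum>x\<leftarrow>p. norm x powr r) t" .
  qed
qed

section \<open>Haar polynomials\<close>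

lemma mem_dyadic_iff: "t \<in> dyadic k j \<longleftrightarrow> j = \<lfloor>t * 2 ^ k\<rfloor> + 1"
  by (auto simp: dyadic_def floor_eq_iff field_simps; linarith)

text \<open>Intervals are numbered from 1. With \<open>a\<close> counted from 0 the halves of number
  \<open>a\<close> are \<open>2 * a\<close> and \<open>2 * a + 1\<close>; the form
  \<open>2 * a + 1 + 1\<close> keeps the pattern \<open>a + 1\<close>.\<close>

lemma dyadic_split:
  shows "dyadic k (a + 1) = dyadic (Suc k) (2 * a + 1) \<union> dyadic (Suc k) (2 * a + 1 + 1)"
    and "dyadic (Suc k) (2 * a + 1) \<inter> dyadic (Suc k) (2 * a + 1 + 1) = {}"
  by (auto simp: dyadic_def field_simps)

lemma dyadic_subset_unit:
  assumes "0 \<le> a" "a < 2 ^ k"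
  shows "dyadic k (a + 1) \<subseteq> {0..<1}"
proof -
  have "real_of_int (a + 1) \<le> 2 ^ k"
    using assms by (metis of_int_le_iff of_int_numeral of_int_power zless_imp_add1_zle)
  then show ?thesis
    using assms(1) by (auto simp: dyadic_def field_simps intro: order.trans less_le_trans)
qed

definition haar_level :: "(nat \<Rightarrow> int \<Rightarrow> 'a::real_normed_vector) \<Rightarrow> nat \<Rightarrow> real \<Rightarrow> 'a" where
  "haar_level x k t = (\<Sum>j = 1..(2::int) ^ (k - 1). haar k j t *\<^sub>R x k j)"

text \<open>The levels \<open>k + 1\<close> to \<open>k + m\<close> seen from the interval
  \<open>dyadic k (a + 1)\<close>. The factor is the height of the Haar functions of level
  \<open>Suc k\<close>.\<close>

fun haar_tree :: "(nat \<Rightarrow> int \<Rightarrow> 'a::real_normed_vector) \<Rightarrow> nat \<Rightarrow> nat \<Rightarrow> int \<Rightarrow> 'a mtree" where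
  "haar_tree x 0 k a = Leaf"
| "haar_tree x (Suc m) k a = Node (2 powr (real k / 2) *\<^sub>R x (Suc k) (a + 1))
     (haar_tree x m (Suc k) (2 * a)) (haar_tree x m (Suc k) (2 * a + 1))"

lemma haar_level_eq:
  fixes x :: "nat \<Rightarrow> int \<Rightarrow> 'a::real_normed_vector"
  assumes "0 \<le> a" "a < 2 ^ k"
  shows "t \<in> dyadic (Suc k) (2 * a + 1) \<Longrightarrow>
      haar_level x (Suc k) t = 2 powr (real k / 2) *\<^sub>R x (Suc k) (a + 1)"
    and "t \<in> dyadic (Suc k) (2 * a + 1 + 1) \<Longrightarrow>
      haar_level x (Suc k) t = - (2 powr (real k / 2) *\<^sub>R x (Suc k) (a + 1))"
proof -
  \<comment> \<open>At each point at most one Haar function of a level is nonzero.\<close>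
  have single: "haar_level x (Suc k) t = c *\<^sub>R x (Suc k) (a + 1)"
    if "\<And>j. haar (Suc k) j t = (if j = a + 1 then c else 0)" for c
  proof -
    have "haar_level x (Suc k) t = (\<Sum>j = 1..(2::int) ^ k. if j = a + 1 then c *\<^sub>R x (Suc k) j else 0)"
      unfolding haar_level_def by (intro sum.cong) (auto simp: that)
    then show ?thesis using assms by simp
  qed
  note unit = dyadic_split(1)[of k a] dyadic_subset_unit[OF assms]
  show "haar_level x (Suc k) t = 2 powr (real k / 2) *\<^sub>R x (Suc k) (a + 1)"
    if t: "t \<in> dyadic (Suc k) (2 * a + 1)"
  proof (rule single)
    have "t \<in> {0..<1}" using t unit by auto
    moreover have "\<lfloor>t * 2 ^ Suc k\<rfloor> = 2 * a"
      using t unfolding mem_dyadic_iff by simp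
    ultimately show "haar (Suc k) j t = (if j = a + 1 then 2 powr (real k / 2) else 0)" for j
      unfolding haar_def mem_dyadic_iff by (auto; presburger)
  qed
  show "haar_level x (Suc k) t = - (2 powr (real k / 2) *\<^sub>R x (Suc k) (a + 1))"
    if t: "t \<in> dyadic (Suc k) (2 * a + 1 + 1)"
  proof -
    have "t \<in> {0..<1}" using t unit by auto
    moreover have "\<lfloor>t * 2 ^ Suc k\<rfloor> = 2 * a + 1"
      using t unfolding mem_dyadic_iff by simp
    ultimately have "haar (Suc k) j t = (if j = a + 1 then - (2 powr (real k / 2)) else 0)" for j
      unfolding haar_def mem_dyadic_iff by (auto; presburger)
    then show ?thesis
      using single[of "- (2 powr (real k / 2))"] by simp
  qed
qed

section \<open>Integrals as tree expectations\<close>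

lemma has_bochner_integral_dyadic:
  fixes c :: real
  shows "has_bochner_integral lborel (\<lambda>t. indicator (dyadic k j) t * c) (c / 2 ^ k)"
proof -
  have "has_bochner_integral lborel (indicator (dyadic k j) :: real \<Rightarrow> real) (measure lborel (dyadic k j))"
    unfolding dyadic_def
    by (intro has_bochner_integral_real_indicator) (auto simp: emeasure_lborel_Ico divide_right_mono)
  then have "has_bochner_integral lborel (\<lambda>t. indicator (dyadic k j) t * c) (measure lborel (dyadic k j) * c)"
    by (intro has_bochner_integral_mult_left) auto
  moreover have "measure lborel (dyadic k j) = 1 / 2 ^ k"
    unfolding dyadic_def by (subst measure_lborel_Ico) (auto simp: field_simps)
  ultimately show ?thesis by simp
qed

text \<open>On each half the first level is constant, so it can be absorbed into \<open>F\<close>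
  and the deeper levels follow by induction. \<open>F\<close> can be arbitrary because the list
  takes finitely many values, each on a union of dyadic intervals.\<close>

lemma has_bochner_integral_haar_tree:
  fixes x :: "nat \<Rightarrow> int \<Rightarrow> 'a::real_normed_vector"
  assumes "0 \<le> a" "a < 2 ^ k"
  shows "has_bochner_integral lborel
    (\<lambda>t. indicator (dyadic k (a + 1)) t * F (map (\<lambda>i. haar_level x i t) [Suc k..<Suc k + m]))
    (expect F (haar_tree x m k a) / 2 ^ k)"
  using assms
proof (induction m arbitrary: k a F)
  case 0
  then show ?case using has_bochner_integral_dyadic by simp
next
  case (Suc m)
  define X where "X = 2 powr (real k / 2) *\<^sub>R x (Suc k) (a + 1)"
  let ?p = "\<lambda>t. map (\<lambda>i. haar_level x i t) [Suc (Suc k)..<Suc (Suc k) + m]"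
  have upt: "[Suc k..<Suc k + Suc m] = Suc k # [Suc (Suc k)..<Suc (Suc k) + m]"
    by (simp add: upt_rec)
  have "has_bochner_integral lborel (\<lambda>t. indicator (dyadic (Suc k) (2 * a + 1)) t * F (X # ?p t)
        + indicator (dyadic (Suc k) (2 * a + 1 + 1)) t * F (- X # ?p t))
      (expect (\<lambda>p. F (X # p)) (haar_tree x m (Suc k) (2 * a)) / 2 ^ Suc k
       + expect (\<lambda>p. F (- X # p)) (haar_tree x m (Suc k) (2 * a + 1)) / 2 ^ Suc k)"
    by (intro has_bochner_integral_add Suc.IH) (use Suc.prems in auto)
  also have "(\<lambda>t. indicator (dyadic (Suc k) (2 * a + 1)) t * F (X # ?p t)
        + indicator (dyadic (Suc k) (2 * a + 1 + 1)) t * F (- X # ?p t))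
      = (\<lambda>t. indicator (dyadic k (a + 1)) t * F (map (\<lambda>i. haar_level x i t) [Suc k..<Suc k + Suc m]))"
    (is "?f = ?g")
  proof
    fix t
    show "?f t = ?g t"
      using dyadic_split[of k a] haar_level_eq[OF Suc.prems, of t x]
      unfolding upt X_def by (auto simp: indicator_def simp del: upt_Suc)
  qed
  also have "expect (\<lambda>p. F (X # p)) (haar_tree x m (Suc k) (2 * a)) / 2 ^ Suc k
       + expect (\<lambda>p. F (- X # p)) (haar_tree x m (Suc k) (2 * a + 1)) / 2 ^ Suc k
      = expect F (haar_tree x (Suc m) k a) / 2 ^ k"
    by (simp add: X_def field_simps)
  finally show ?case .
qed

lemma set_integral_haar_tree:
  fixes x :: "nat \<Rightarrow> int \<Rightarrow> 'a::real_normed_vector"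
  shows "set_integrable lborel {0..<1} (\<lambda>t. F (map (\<lambda>i. haar_level x i t) [1..<Suc n]))"
    and "(LINT t:{0..<1}|lborel. F (map (\<lambda>i. haar_level x i t) [1..<Suc n])) = expect F (haar_tree x n 0 0)"
proof -
  have "dyadic 0 1 = {0..<1}"
    by (auto simp: dyadic_def)
  then have "has_bochner_integral lborel
      (\<lambda>t. indicator {0..<1} t *\<^sub>R F (map (\<lambda>i. haar_level x i t) [1..<Suc n])) (expect F (haar_tree x n 0 0))"
    using has_bochner_integral_haar_tree[of 0 0 F x n] by simp
  then show "set_integrable lborel {0..<1} (\<lambda>t. F (map (\<lambda>i. haar_level x i t) [1..<Suc n]))"
    and "(LINT t:{0..<1}|lborel. F (map (\<lambda>i. haar_level x i t) [1..<Suc n])) = expect F (haar_tree x n 0 0)"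
    unfolding set_integrable_def set_lebesgue_integral_def
    by (auto simp: has_bochner_integral_iff)
qed

section \<open>Both sides of the type inequalities on trees\<close>

lemma DD_eq_Sigma: "DD n = Sigma {1..n} (\<lambda>k. {1..(2::int) ^ (k - 1)})"
  by (auto simp: DD_def)

lemma sum_DD_eq_sum_list:
  fixes x :: "nat \<Rightarrow> int \<Rightarrow> 'a::real_normed_vector"
  assumes "linear T"
  shows "(\<Sum>(k, j)\<in>DD n. haar k j t *\<^sub>R T (x k j)) = (\<Sum>y\<leftarrow>map (\<lambda>i. haar_level x i t) [1..<Suc n]. T y)"
proof -
  have "(\<Sum>(k, j)\<in>DD n. haar k j t *\<^sub>R T (x k j)) = (\<Sum>k = 1..n. T (haar_level x k t))"
    unfolding DD_eq_Sigma haar_level_def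
    by (subst sum.Sigma[symmetric]) (auto simp: linear_sum[OF assms] linear_scale[OF assms])
  then show ?thesis
    by (simp add: interv_sum_list_conv_sum_set_nat o_def atLeastLessThanSuc_atLeastAtMost del: upt_Suc)
qed

lemma Lq_norm_haar_sum:
  fixes x :: "nat \<Rightarrow> int \<Rightarrow> 'a::real_normed_vector"
  assumes "linear T"
  shows "Lq_norm q (\<lambda>t. \<Sum>(k, j)\<in>DD n. haar k j t *\<^sub>R T (x k j))
    = expect (\<lambda>p. norm (\<Sum>y\<leftarrow>p. T y) powr q) (haar_tree x n 0 0) powr (1 / q)"
  unfolding Lq_norm_def sum_DD_eq_sum_list[OF assms]
  by (subst set_integral_haar_tree(2)[of "\<lambda>p. norm (\<Sum>y\<leftarrow>p. T y) powr q", symmetric]) simp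

lemma sum_Lq_norm_haar_level:
  fixes x :: "nat \<Rightarrow> int \<Rightarrow> 'a::real_normed_vector"
  assumes "0 < q"
  shows "(\<Sum>k = 1..n. Lq_norm q (\<lambda>t. \<Sum>j = 1..(2::int) ^ (k - 1). haar k j t *\<^sub>R x k j) powr q)
    = expect (\<lambda>p. \<Sum>y\<leftarrow>p. norm y powr q) (haar_tree x n 0 0)"
proof -
  have int: "set_integrable lborel {0..<1} (\<lambda>t. norm (haar_level x k t) powr q)" if "k \<in> {1..n}" for k
  proof -
    \<comment> \<open>Integrability of one level comes from the functional that reads a single list
      entry; entry \<open>k - 1\<close> is level \<open>k\<close>, since lists are indexed from
      0.\<close>
    have "map (\<lambda>i. haar_level x i t) [1..<Suc n] ! (k - 1) = haar_level x k t" for t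
      using that by (subst nth_map) (auto simp del: upt_Suc)
    then show ?thesis
      using set_integral_haar_tree(1)[of "\<lambda>p. norm (p ! (k - 1)) powr q" x n] by (simp only:)
  qed
  have "Lq_norm q (haar_level x k) powr q = (LINT t:{0..<1}|lborel. norm (haar_level x k t) powr q)" for k
    using assms by (simp add: Lq_norm_def powr_powr set_lebesgue_integral_def)
  then have "(\<Sum>k = 1..n. Lq_norm q (haar_level x k) powr q)
      = (LINT t:{0..<1}|lborel. (\<Sum>k = 1..n. norm (haar_level x k t) powr q))"
    using int unfolding set_lebesgue_integral_def set_integrable_def scaleR_sum_right
    by (subst Bochner_Integration.integral_sum) auto
  also have "\<dots> = (LINT t:{0..<1}|lborel. (\<Sum>y\<leftarrow>map (\<lambda>i. haar_level x i t) [1..<Suc n]. norm y powr q))"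
    by (simp add: interv_sum_list_conv_sum_set_nat o_def atLeastLessThanSuc_atLeastAtMost del: upt_Suc)
  also have "\<dots> = expect (\<lambda>p. \<Sum>y\<leftarrow>p. norm y powr q) (haar_tree x n 0 0)"
    by (rule set_integral_haar_tree(2))
  finally show ?thesis
    by (simp add: haar_level_def[abs_def])
qed

text \<open>The squared height of a Haar function cancels the probability of reaching its support,
  so all coefficients count equally; \<open>2 ^ k\<close> remains because the expectation is
  conditional on one interval of generation \<open>k\<close>.\<close>

lemma expect_squares_haar_tree_aux:
  fixes x :: "nat \<Rightarrow> int \<Rightarrow> 'a::real_normed_vector"
  shows "expect (\<lambda>p. \<Sum>y\<leftarrow>p. (norm y)\<^sup>2) (haar_tree x m k a)
    = 2 ^ k * (\<Sum>i<m. \<Sum>j = a * 2 ^ i + 1..(a + 1) * 2 ^ i. (norm (x (Suc (k + i)) j))\<^sup>2)"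
proof (induction m arbitrary: k a)
  case (Suc m)
  let ?G = "\<lambda>i j. (norm (x (Suc (Suc (k + i))) j))\<^sup>2"
  \<comment> \<open>The descendants of the two children at depth \<open>i\<close> are those of the
    node at depth \<open>Suc i\<close>.\<close>
  have merge: "(\<Sum>j = 2 * a * 2 ^ i + 1..(2 * a + 1) * 2 ^ i. ?G i j)
      + (\<Sum>j = (2 * a + 1) * 2 ^ i + 1..(2 * a + 1 + 1) * 2 ^ i. ?G i j)
      = (\<Sum>j = a * 2 ^ Suc i + 1..(a + 1) * 2 ^ Suc i. ?G i j)" for i
    by (subst sum.union_disjoint[symmetric]) (auto intro!: sum.cong simp: algebra_simps)
  have "(norm (2 powr (real k / 2) *\<^sub>R x (Suc k) (a + 1)))\<^sup>2 = 2 ^ k * (norm (x (Suc k) (a + 1)))\<^sup>2"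
    by (simp add: power_mult_distrib powr_powr powr_realpow flip: powr_numeral)
  then have "expect (\<lambda>p. \<Sum>y\<leftarrow>p. (norm y)\<^sup>2) (haar_tree x (Suc m) k a)
      = 2 ^ k * ((norm (x (Suc k) (a + 1)))\<^sup>2 +
          (\<Sum>i<m. (\<Sum>j = 2 * a * 2 ^ i + 1..(2 * a + 1) * 2 ^ i. ?G i j)
            + (\<Sum>j = (2 * a + 1) * 2 ^ i + 1..(2 * a + 1 + 1) * 2 ^ i. ?G i j)))"
    using Suc.IH[of "Suc k" "2 * a"] Suc.IH[of "Suc k" "2 * a + 1"]
    by (simp add: expect_add expect_const sum.distrib algebra_simps)
  then show ?case
    unfolding merge by (simp add: sum.lessThan_Suc_shift del: sum.lessThan_Suc)
qed simp

lemma sum_DD_squares: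
  fixes x :: "nat \<Rightarrow> int \<Rightarrow> 'a::real_normed_vector"
  shows "(\<Sum>(k, j)\<in>DD n. (norm (x k j))\<^sup>2) = expect (\<lambda>p. \<Sum>y\<leftarrow>p. (norm y)\<^sup>2) (haar_tree x n 0 0)"
proof -
  have "(\<Sum>(k, j)\<in>DD n. (norm (x k j))\<^sup>2) = (\<Sum>k = 1..n. \<Sum>j = 1..(2::int) ^ (k - 1). (norm (x k j))\<^sup>2)"
    unfolding DD_eq_Sigma by (subst sum.Sigma[symmetric]) auto
  also have "\<dots> = (\<Sum>i<n. \<Sum>j = 1..(2::int) ^ i. (norm (x (Suc i) j))\<^sup>2)"
    by (simp add: sum.atLeast1_atMost_eq)
  finally show ?thesis
    unfolding expect_squares_haar_tree_aux by simp
qed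

section \<open>Complete trees as Haar polynomials\<close>

fun left_child :: "'a mtree \<Rightarrow> 'a mtree" where
  "left_child (Node x l r) = l"
| "left_child Leaf = Leaf"

fun right_child :: "'a mtree \<Rightarrow> 'a mtree" where
  "right_child (Node x l r) = r"
| "right_child Leaf = Leaf"

fun root_value :: "'a::zero mtree \<Rightarrow> 'a" where
  "root_value (Node x l r) = x"
| "root_value Leaf = 0"

text \<open>Addresses by generation and position from 0: the parent of position \<open>a\<close> is
  \<open>a div 2\<close>, and parity selects the child.\<close>

fun subtree :: "'a mtree \<Rightarrow> nat \<Rightarrow> int \<Rightarrow> 'a mtree" where
  "subtree t 0 a = t"
| "subtree t (Suc k) a =
     (if even a then left_child (subtree t k (a div 2)) else right_child (subtree t k (a div 2)))"

text \<open>Makes inequalities quantified over Haar coefficients available for all complete trees,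
  including those built by compression.\<close>

lemma complete_tree_eq_haar_tree:
  fixes t :: "'a::real_normed_vector mtree"
  assumes "complete_tree n t"
  obtains x where "haar_tree x n 0 0 = t"
proof
  \<comment> \<open>Undoes the height factor of \<open>haar_tree\<close>; both indices are shifted
    by one because coefficients are numbered from 1.\<close>
  define x where "x = (\<lambda>k j. 2 powr (- (real (k - 1) / 2)) *\<^sub>R root_value (subtree t (k - 1) (j - 1)))"
  have "haar_tree x m k a = subtree t k a" if "complete_tree m (subtree t k a)" for m k a
    using that
  proof (induction m arbitrary: k a)
    case 0
    then show ?case by (cases "subtree t k a") auto
  next
    case (Suc m)
    then obtain y l r where y: "subtree t k a = Node y l r" "complete_tree m l" "complete_tree m r"
      by (cases "subtree t k a") auto
    then show ?case
      using Suc.IH[of "Suc k" "2 * a"] Suc.IH[of "Suc k" "2 * a + 1"]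
      by (simp add: x_def powr_add[symmetric])
  qed
  from this[of n 0 0] show "haar_tree x n 0 0 = t"
    using assms by simp
qed

section \<open>From the infima to inequalities and back\<close>

lemma complete_haar_tree: "complete_tree n (haar_tree x n k a)"
  by (induction n arbitrary: k a) auto

lemma length_paths_complete_tree: "complete_tree n t \<Longrightarrow> p \<in> paths t \<Longrightarrow> length p = n"
  by (induction t arbitrary: n p) auto

text \<open>A crude pathwise bound by Cauchy-Schwarz, which supplies an admissible constant for
  \<open>haar_tau\<close>.\<close>

lemma expect_square_le_length:
  fixes T :: "'a::real_normed_vector \<Rightarrow> 'b::real_normed_vector"
  assumes "\<And>x. norm (T x) \<le> B * norm x" "complete_tree n t"
  shows "expect (\<lambda>p. (norm (\<Sum>x\<leftarrow>p. T x))\<^sup>2) t \<le> B\<^sup>2 * real n * expect (\<lambda>p. \<Sum>x\<leftarrow>p. (norm x)\<^sup>2) t"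
proof -
  have "(norm (\<Sum>x\<leftarrow>p. T x))\<^sup>2 \<le> B\<^sup>2 * real n * (\<Sum>x\<leftarrow>p. (norm x)\<^sup>2)" if "p \<in> paths t" for p
  proof -
    have n: "length p = n"
      using length_paths_complete_tree assms(2) that by blast
    have "norm (\<Sum>x\<leftarrow>p. T x) \<le> (\<Sum>x\<leftarrow>p. B * norm x)"
    proof (induction p)
      case (Cons x p)
      then show ?case
        using norm_triangle_ineq[of "T x" "\<Sum>x\<leftarrow>p. T x"] assms(1)[of x] by simp
    qed simp
    also have "\<dots> = (\<Sum>i<n. 1 * (B * norm (p ! i)))"
      using n by (simp add: sum_list_sum_nth atLeast0LessThan)
    finally have "(norm (\<Sum>x\<leftarrow>p. T x))\<^sup>2 \<le> (\<Sum>i<n. 1 * (B * norm (p ! i)))\<^sup>2"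
      by (intro power_mono) auto
    also have "\<dots> \<le> (\<Sum>i<n. 1\<^sup>2) * (\<Sum>i<n. (B * norm (p ! i))\<^sup>2)"
      by (rule Cauchy_Schwarz_ineq_sum)
    also have "\<dots> = B\<^sup>2 * real n * (\<Sum>x\<leftarrow>p. (norm x)\<^sup>2)"
      using n by (simp add: sum_list_sum_nth atLeast0LessThan power_mult_distrib sum_distrib_left mult_ac)
    finally show ?thesis .
  qed
  then show ?thesis
    unfolding expect_cmult[symmetric] by (rule expect_mono)
qed

text \<open>The infimum is itself admissible: every admissible constant is at least the quotient of
  the two sides for the given tree.\<close>

lemma le_haar_tau:
  fixes T :: "'a::real_normed_vector \<Rightarrow> 'b::real_normed_vector"
  assumes "bounded_linear T" "complete_tree n t"
  shows "sqrt (expect (\<lambda>p. (norm (\<Sum>y\<leftarrow>p. T y))\<^sup>2) t)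
    \<le> haar_tau n T * sqrt (expect (\<lambda>p. \<Sum>y\<leftarrow>p. (norm y)\<^sup>2) t)"
proof -
  have lin: "linear T" using assms(1) by (rule bounded_linear.linear)
  define V where "V = (\<lambda>t. sqrt (expect (\<lambda>p. (norm (\<Sum>y\<leftarrow>p. T y))\<^sup>2) t))"
  define N where "N = (\<lambda>t::'a mtree. sqrt (expect (\<lambda>p. \<Sum>y\<leftarrow>p. (norm y)\<^sup>2) t))"
  have N: "0 \<le> N t" for t
    by (auto simp: N_def intro!: expect_nonneg sum_list_nonneg)
  have "Lq_norm 2 (\<lambda>t. \<Sum>(k, j)\<in>DD n. haar k j t *\<^sub>R T (x k j)) = V (haar_tree x n 0 0)"
    for x :: "nat \<Rightarrow> int \<Rightarrow> 'a"
    by (simp add: Lq_norm_haar_sum[OF lin] V_def powr_half_sqrt expect_nonneg)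
  then have tau: "haar_tau n T = Inf {c. 0 \<le> c \<and> (\<forall>x. V (haar_tree x n 0 0) \<le> c * N (haar_tree x n 0 0))}"
    (is "_ = Inf ?C") by (simp add: haar_tau_def sum_DD_squares N_def)
  obtain B where B: "\<And>x. norm (T x) \<le> B * norm x" "0 \<le> B"
    using bounded_linear.nonneg_bounded[OF assms(1)] by (auto simp: mult.commute)
  have bound: "V t \<le> B * sqrt (real n) * N t" if "complete_tree n t" for t
    using real_sqrt_le_mono[OF expect_square_le_length[OF B(1) that]] B(2)
    by (simp add: V_def N_def real_sqrt_mult)
  \<comment> \<open>Without an admissible constant \<open>Inf\<close> would carry no
    information.\<close>
  have ne: "B * sqrt (real n) \<in> ?C"
    using B(2) bound[OF complete_haar_tree] by simp
  obtain x where x: "haar_tree x n 0 0 = t"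
    using assms(2) by (rule complete_tree_eq_haar_tree)
  have le: "V t \<le> c * N t" if "c \<in> ?C" for c
    using that x by auto
  have "V t \<le> haar_tau n T * N t"
  \<comment> \<open>If the right side vanishes there is no quotient, but any one admissible constant
    forces the left side to be at most 0.\<close>
  proof (cases "N t = 0")
    case False
    then have "V t / N t \<le> Inf ?C"
      using ne le N[of t] by (intro cInf_greatest) (auto simp: divide_le_eq less_le)
    then show ?thesis
      using False N[of t] by (simp add: tau divide_le_eq less_le)
  qed (use le[OF ne] in simp)
  then show ?thesis
    by (simp add: V_def N_def)
qed

lemma haar_tau_q_le:
  fixes T :: "'a::real_normed_vector \<Rightarrow> 'b::real_normed_vector"
  assumes "linear T" "0 < q" "0 \<le> C"
    and "\<And>t. expect (\<lambda>p. norm (\<Sum>y\<leftarrow>p. T y) powr q) t \<le> C * expect (\<lambda>p. \<Sum>y\<leftarrow>p. norm y powr q) t"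
  shows "haar_tau_q q n T \<le> C powr (1 / q)"
proof -
  have "expect (\<lambda>p. norm (\<Sum>y\<leftarrow>p. T y) powr q) t powr (1 / q)
      \<le> C powr (1 / q) * expect (\<lambda>p. \<Sum>y\<leftarrow>p. norm y powr q) t powr (1 / q)" for t
    using powr_mono2[OF _ _ assms(4)[of t], of "1 / q"] assms(2,3)
    by (simp add: powr_mult expect_nonneg sum_list_nonneg)
  then show ?thesis
    unfolding haar_tau_q_def sum_Lq_norm_haar_level[OF assms(2)] Lq_norm_haar_sum[OF assms(1)]
    by (intro cInf_lower bdd_belowI[of _ 0]) auto
qed

theorem theorem5p5:
  fixes T :: "'a::banach \<Rightarrow> 'b::banach" and p r :: real
  assumes "bounded_linear T"
    and "1 \<le> p" and "p < 2"
    and "weak_haar_type p T"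
    and "1 \<le> r" and "r < p"
  shows "haar_type r T"
proof -
  have lin: "linear T" using assms(1) by (rule bounded_linear.linear)
  define \<delta> where "\<delta> = 1 / p - 1 / 2"
  \<comment> \<open>With \<open>2 * \<delta>\<close> as exponent for squares,
    \<open>2 * \<delta> + 1\<close> equals \<open>2 / p\<close>, so the second claim is
    \<open>r < p\<close>.\<close>
  have \<delta>: "0 \<le> 2 * \<delta>" "r * (2 * \<delta> + 1) < 2"
    using assms by (auto simp: \<delta>_def field_simps)
  obtain c where c: "0 \<le> c" "\<And>n. 1 \<le> n \<Longrightarrow> haar_tau n T \<le> c * real n powr \<delta>"
    using assms(4) by (auto simp: weak_haar_type_def \<delta>_def)
  have hyp: "expect (\<lambda>p. (norm (\<Sum>x\<leftarrow>p. T x))\<^sup>2) t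
      \<le> c\<^sup>2 * real n powr (2 * \<delta>) * expect (\<lambda>p. \<Sum>x\<leftarrow>p. (norm x)\<^sup>2) t"
    if t: "complete_tree n t" for n t
  \<comment> \<open>The weak type bound starts at \<open>n = 1\<close>; for \<open>n = 0\<close>
    both expectations are 0.\<close>
  proof (cases "n = 0")
    case True
    then have "t = Leaf" using t by (cases t) auto
    then show ?thesis by simp
  next
    case False
    let ?N = "expect (\<lambda>p. \<Sum>x\<leftarrow>p. (norm x)\<^sup>2) t"
    have N: "0 \<le> ?N" by (intro expect_nonneg sum_list_nonneg) auto
    have "sqrt (expect (\<lambda>p. (norm (\<Sum>x\<leftarrow>p. T x))\<^sup>2) t) \<le> haar_tau n T * sqrt ?N"
      using assms(1) t by (rule le_haar_tau)
    also have "\<dots> \<le> c * real n powr \<delta> * sqrt ?N"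
      using c(2)[of n] False N by (intro mult_right_mono) auto
    finally have "expect (\<lambda>p. (norm (\<Sum>x\<leftarrow>p. T x))\<^sup>2) t \<le> (c * real n powr \<delta> * sqrt ?N)\<^sup>2"
      by (rule sqrt_le_D)
    also have "\<dots> = c\<^sup>2 * real n powr (2 * \<delta>) * ?N"
      using N by (simp add: power_mult_distrib) (simp add: power2_eq_square powr_add[symmetric])
    finally show ?thesis .
  qed
  have "0 < r" using assms by simp
  obtain C where C: "0 \<le> C"
    "\<And>t. expect (\<lambda>p. norm (\<Sum>x\<leftarrow>p. T x) powr r) t \<le> C * expect (\<lambda>p. \<Sum>x\<leftarrow>p. norm x powr r) t"
    using expect_powr_le[OF lin zero_le_power2[of c] \<delta>(1) \<open>0 < r\<close> \<delta>(2) hyp] by blast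
  show ?thesis
    unfolding haar_type_def
    \<comment> \<open>The tree inequality holds with one \<open>C\<close> for trees of every depth,
      so the bound is uniform in \<open>n\<close>.\<close>
    using haar_tau_q_le[OF lin \<open>0 < r\<close> C] by (intro bdd_aboveI[of _ "C powr (1 / r)"]) auto
qed

end
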